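(* Assume $d\ge 3$, $1\le l\le d-2$ and $\Delta(x^0)\neq 0$. Then every subsystem of the iterated differential system $$\frac{\partial y_1}{\partial t_1}(t_1)=v_1(y_1(t_1)),\quad y_1(0)=x^0,$$ $$\frac{\partial y_j}{\partial t_j}(t_1,\dots,t_j)=v_j(y_j(t_1,\dots,t_j)),\quad y_j(t_1,\dots,t_{j-1},0)=y_{j-1}(t_1,\dots,t_{j-1}),\qquad j=2,\dots,d-l,$$ has a unique solution (each $j$-th subsystem being regarded as an ordinary differential system in $V$ in the variable $t_j$, with $t_1,\dots,t_{j-1}$ as parameters, on an interval containing $0$ in its interior; uniqueness means that any two solutions coincide on their common interval of definition).
   Context: Setting: $\Omega\subset\mathbb{R}^d$ is a bounded domain, $x^0\in\Omega$, $F_1,\dots,F_l\in C^1(\Omega)$ are real valued and $F_j(x^0)=0$ for $j=1,\dots,l$. Let $A(x)=\left(\frac{\partial F_i}{\partial x_j}(x)\right)_{1\le i,j\le l}$ and $\Delta(x)=\det A(x)$. When $\Delta(x^0)\ne0$, $V\subset\Omega$ denotes an open neighbourhood of $x^0$ on which $\Delta\neq 0$. Vector fields: for $s=1,\dots,d-l$ and $x\in V$, $v_s(x)\in\mathbb{R}^d$ is the unique vector with $v_s(x)\cdot\nabla F_j(x)=0$ for $j=1,\dots,l$ whose last $d-l$ components are the $s$-th row of the identity matrix of $\mathbb{R}^{d-l}$ multiplied by $\Delta(x)$ (the $(l+s)$-th component is $\Delta(x)$ and the other components with index in $\{l+1,\dots,d\}$ are $0$). These fields are continuous on $V$. *)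

theory Defs
  imports "HOL-Analysis.Analysis"
begin

text \<open>
  Points of \<open>\<real>\<^sup>d\<close> have the type \<^typ>\<open>real ^ ('l + 'm)\<close>, where \<open>CARD('l) = l\<close> and
  \<open>CARD('m) = d - l\<close>: the coordinates \<open>Inl i\<close> are the first \<open>l\<close> ones, the coordinates \<open>Inr k\<close>
  the last \<open>d - l\<close> ones. The functions \<open>F\<^sub>1, \<dots>, F\<^sub>l\<close> are indexed by the same type \<open>'l\<close> as the
  first \<open>l\<close> coordinates.
\<close>

definition partial_deriv :: "'n \<Rightarrow> (real ^ 'n::finite \<Rightarrow> real) \<Rightarrow> real ^ 'n \<Rightarrow> real" where
  "partial_deriv j f x = deriv (\<lambda>t. f (x + t *\<^sub>R axis j 1)) 0"

definition gradient :: "(real ^ 'n::finite \<Rightarrow> real) \<Rightarrow> real ^ 'n \<Rightarrow> real ^ 'n" where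
  "gradient f x = (\<chi> j. partial_deriv j f x)"

definition C1_on :: "(real ^ 'n::finite) set \<Rightarrow> (real ^ 'n \<Rightarrow> real) \<Rightarrow> bool" where
  "C1_on S f \<longleftrightarrow> (\<forall>x\<in>S. f differentiable (at x)) \<and> (\<forall>j. continuous_on S (partial_deriv j f))"

definition jac :: "('l::finite \<Rightarrow> real ^ ('l + 'm::finite) \<Rightarrow> real) \<Rightarrow> real ^ ('l + 'm) \<Rightarrow> real ^ 'l ^ 'l"
  where "jac F x = (\<chi> i j. partial_deriv (Inl j) (F i) x)"

definition jac_det :: "('l::finite \<Rightarrow> real ^ ('l + 'm::finite) \<Rightarrow> real) \<Rightarrow> real ^ ('l + 'm) \<Rightarrow> real"
  where "jac_det F x = det (jac F x)"

definition vfield ::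
    "('l::finite \<Rightarrow> real ^ ('l + 'm::finite) \<Rightarrow> real) \<Rightarrow> 'm \<Rightarrow> real ^ ('l + 'm) \<Rightarrow> real ^ ('l + 'm)"
  where "vfield F s x =
    (THE w. (\<forall>j. w \<bullet> gradient (F j) x = 0) \<and>
            (\<forall>k. w $ Inr k = (if k = s then jac_det F x else 0)))"

text \<open>The description in \<^const>\<open>vfield\<close> is proper wherever \<^const>\<open>jac_det\<close> does not vanish.\<close>

lemma vfield_ex1:
  fixes F :: "'l::finite \<Rightarrow> real ^ ('l + 'm::finite) \<Rightarrow> real"
  assumes "jac_det F x \<noteq> 0"
  shows "\<exists>!w. (\<forall>j. w \<bullet> gradient (F j) x = 0) \<and>
              (\<forall>k. w $ Inr k = (if k = s then jac_det F x else 0))"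
proof -
  define c where "c k = (if k = s then jac_det F x else 0)" for k
  define r :: "real ^ 'l" where "r = (\<chi> j. - (\<Sum>k\<in>UNIV. c k * partial_deriv (Inr k) (F j) x))"
  have split: "(w \<bullet> gradient (F j) x = 0) \<longleftrightarrow> (jac F x *v (\<chi> i. w $ Inl i)) $ j = r $ j"
    if "\<forall>k. w $ Inr k = c k" for w :: "real ^ ('l + 'm)" and j
  proof -
    have "w \<bullet> gradient (F j) x = (\<Sum>i\<in>UNIV <+> UNIV. w $ i * partial_deriv i (F j) x)"
      by (simp add: inner_vec_def gradient_def)
    also have "\<dots> = (\<Sum>i\<in>UNIV. w $ Inl i * partial_deriv (Inl i) (F j) x)
                 + (\<Sum>k\<in>UNIV. c k * partial_deriv (Inr k) (F j) x)"
      using that by (subst sum.Plus) auto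
    finally show ?thesis
      by (auto simp: matrix_vector_mult_def jac_def r_def mult.commute)
  qed
  have "invertible (jac F x)"
    using assms by (simp add: invertible_det_nz jac_det_def)
  then obtain B where B: "jac F x ** B = mat 1" "B ** jac F x = mat 1"
    by (auto simp: invertible_def)
  have sol: "jac F x *v u = r \<longleftrightarrow> u = B *v r" for u
    by (metis B matrix_vector_mul_assoc matrix_vector_mul_lid)
  define w0 :: "real ^ ('l + 'm)" where
    "w0 = (\<chi> i. case i of Inl a \<Rightarrow> (B *v r) $ a | Inr k \<Rightarrow> c k)"
  have key: "(\<forall>j. w \<bullet> gradient (F j) x = 0) \<and> (\<forall>k. w $ Inr k = c k) \<longleftrightarrow> w = w0" for w
  proof -
    have "(\<forall>j. w \<bullet> gradient (F j) x = 0) \<and> (\<forall>k. w $ Inr k = c k)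
      \<longleftrightarrow> jac F x *v (\<chi> i. w $ Inl i) = r \<and> (\<forall>k. w $ Inr k = c k)"
      using split[of w] by (auto simp: vec_eq_iff)
    also have "\<dots> \<longleftrightarrow> (\<forall>i. w $ Inl i = (B *v r) $ i) \<and> (\<forall>k. w $ Inr k = c k)"
      unfolding sol by (simp add: vec_eq_iff)
    also have "\<dots> \<longleftrightarrow> w = w0"
      by (auto simp: vec_eq_iff w0_def split: sum.splits)
    finally show ?thesis .
  qed
  show ?thesis
    using key unfolding c_def by auto
qed

definition ivp_solution ::
    "'a::real_normed_vector set \<Rightarrow> ('a \<Rightarrow> 'a) \<Rightarrow> 'a \<Rightarrow> real set \<Rightarrow> (real \<Rightarrow> 'a) \<Rightarrow> bool"
  where "ivp_solution V f p I y \<longleftrightarrow>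
    is_interval I \<and> 0 \<in> interior I \<and> y 0 = p \<and>
    (\<forall>t\<in>I. y t \<in> V \<and> (y has_vector_derivative f (y t)) (at t within I))"

text \<open>
  A parameter tuple \<open>(t\<^sub>1, \<dots>, t\<^sub>j)\<close> is a list of length \<open>j\<close>. Given \<open>y'\<close> on a set \<open>D'\<close> of
  tuples \<open>(t\<^sub>1, \<dots>, t\<^bsub>j-1\<^esub>)\<close>, a function \<open>y\<close> on a set \<open>D\<close> of tuples \<open>(t\<^sub>1, \<dots>, t\<^sub>j)\<close> solves
  the next subsystem if over each tuple in \<open>D'\<close> the fibre of \<open>D\<close> is an interval on which \<open>y\<close>, as
  a function of \<open>t\<^sub>j\<close> alone, solves the initial value problem starting at the value of \<open>y'\<close>.
  The interval may depend on the tuple.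
\<close>

definition subsystem_solution ::
    "'a::real_normed_vector set \<Rightarrow> ('a \<Rightarrow> 'a) \<Rightarrow> real list set \<Rightarrow> (real list \<Rightarrow> 'a) \<Rightarrow>
     real list set \<Rightarrow> (real list \<Rightarrow> 'a) \<Rightarrow> bool"
  where "subsystem_solution V f D' y' D y \<longleftrightarrow>
    D \<subseteq> {ts @ [t] | ts t. ts \<in> D'} \<and>
    (\<forall>ts\<in>D'. ivp_solution V f (y' ts) {t. ts @ [t] \<in> D} (\<lambda>t. y (ts @ [t])))"

text \<open>
  The first \<open>n\<close> subsystems. Stage \<open>0\<close> is the constant \<open>p\<close> on the empty tuple, so that the
  condition \<open>y\<^sub>1(0) = p\<close> has the same shape as the initial conditions of the later subsystems.
\<close>

definition iterated_solution ::
    "'a::real_normed_vector set \<Rightarrow> (nat \<Rightarrow> 'a \<Rightarrow> 'a) \<Rightarrow> 'a \<Rightarrow> nat \<Rightarrow>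
     (nat \<Rightarrow> real list set) \<Rightarrow> (nat \<Rightarrow> real list \<Rightarrow> 'a) \<Rightarrow> bool"
  where "iterated_solution V v p n D y \<longleftrightarrow>
    D 0 = {[]} \<and> y 0 [] = p \<and>
    (\<forall>j\<in>{1..n}. subsystem_solution V (v j) (D (j - 1)) (y (j - 1)) (D j) (y j))"

end

theory Submission
  imports Defs
begin

text \<open>
  The fields \<open>v\<^sub>s\<close> are only continuous, so Picard--Lindeloef does not apply.
  The map \<open>G = (F\<^sub>1, \<dots>, F\<^sub>l, x\<^bsub>l+1\<^esub>, \<dots>, x\<^sub>d)\<close> is a local diffeomorphism on \<open>V\<close> with
  \<open>DG \<cdot> v\<^sub>s = \<Delta> e\<^bsub>l+s\<^esub>\<close>, so it carries every solution of \<open>y' = v\<^sub>s(y)\<close> into a line. There the system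
  becomes a scalar equation \<open>r' = \<phi>(r)\<close> with \<open>\<phi>\<close> continuous and nowhere zero, which
  separation of variables solves, with local uniqueness. Uniqueness on whole intervals follows
  by connectedness.
\<close>

section \<open>Separation of variables for a scalar equation\<close>

text \<open>\<open>\<Phi>\<close> is the integral of \<open>1 / \<phi>\<close> from
  \<open>r0\<close>. Its derivative never vanishes, so it is invertible near \<open>r0\<close>, and
  its inverse \<open>h\<close> solves the equation. Later \<open>h\<close> serves existence and
  \<open>\<Phi>\<close> serves uniqueness, since \<open>\<Phi> (r t) - t\<close> is constant along
  any solution \<open>r\<close> with values in \<open>M\<close>.\<close>

lemma separable_ode:
  fixes \<phi> :: "real \<Rightarrow> real"
  assumes "open N" "r0 \<in> N" "continuous_on N \<phi>" and nz: "\<And>r. r \<in> N \<Longrightarrow> \<phi> r \<noteq> 0"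
  obtains M T \<Phi> h where "open M" "r0 \<in> M" "M \<subseteq> N" "open T" "0 \<in> T" "\<Phi> r0 = 0"
    "homeomorphism M T \<Phi> h"
    "\<And>r. r \<in> M \<Longrightarrow> (\<Phi> has_real_derivative 1 / \<phi> r) (at r)"
    "\<And>t. t \<in> T \<Longrightarrow> (h has_real_derivative \<phi> (h t)) (at t)"
proof -
  obtain a where a: "a > 0" "cball r0 a \<subseteq> N"
    using assms(1,2) open_contains_cball by blast
  have cont: "continuous_on N (\<lambda>r. 1 / \<phi> r)"
    using assms by (intro continuous_intros) auto
  moreover have sub: "{r0 - a .. r0 + a} \<subseteq> N"
    using a by (simp add: cball_eq_atLeastAtMost)
  ultimately obtain g where g: "\<And>x. x \<in> {r0 - a .. r0 + a} \<Longrightarrow>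
      (g has_vector_derivative 1 / \<phi> x) (at x within {r0 - a .. r0 + a})"
    using antiderivative_continuous continuous_on_subset by metis
  \<comment> \<open>The normalisation \<open>\<Phi> r0 = 0\<close> makes time 0 correspond to the
    point \<open>r0\<close>.\<close>
  define \<Phi> where "\<Phi> r = g r - g r0" for r
  define U where "U = {r0 - a <..< r0 + a}"
  have \<Phi>: "(\<Phi> has_real_derivative 1 / \<phi> r) (at r)" if "r \<in> U" for r
  proof -
    have "(g has_vector_derivative 1 / \<phi> r) (at r within U)"
      using g[of r] that by (auto simp: U_def intro: has_vector_derivative_within_subset)
    then have "(g has_real_derivative 1 / \<phi> r) (at r)"
      unfolding has_real_derivative_iff_has_vector_derivative
      using at_within_open[of r U] that U_def by (metis open_greaterThanLessThan)
    then show ?thesis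
      unfolding \<Phi>_def by (auto intro!: derivative_eq_intros)
  qed
  \<comment> \<open>The derivative of \<open>\<Phi>\<close> as a bounded linear map, the form in
    which the inverse function theorem asks for its continuity.\<close>
  define D where "D r = blinfun_mult_right (1 / \<phi> r)" for r
  have D: "blinfun_apply (D r) = (*) (1 / \<phi> r)" for r
    by (simp add: D_def)
  have contD: "continuous_on U D"
    by (intro continuous_on_blinfun_componentwise)
      (use continuous_on_subset[OF cont] sub in \<open>auto simp: D U_def subset_iff\<close>)
  have inv: "blinfun_mult_right (\<phi> r0) o\<^sub>L D r0 = id_blinfun"
    by (rule blinfun_eqI) (use nz[OF assms(2)] in \<open>simp add: D\<close>)
  have r0: "r0 \<in> U" "open U" using a by (auto simp: U_def)
  obtain M T h h' where M: "open M" "M \<subseteq> U" "r0 \<in> M" "open T" "\<Phi> r0 \<in> T"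
      "homeomorphism M T \<Phi> h"
    and h: "\<And>t. t \<in> T \<Longrightarrow> (h has_derivative (h' t)) (at t)"
      "\<And>t. t \<in> T \<Longrightarrow> h' t = inv (blinfun_apply (D (h t)))"
    by (rule inverse_function_theorem[of U \<Phi> D r0 "blinfun_mult_right (\<phi> r0)"])
      (use r0 D contD \<Phi> inv in \<open>auto simp: has_field_derivative_def\<close>)
  show thesis
  proof (rule that[of M T \<Phi> h])
    have "U \<subseteq> {r0 - a .. r0 + a}" by (auto simp: U_def)
    then show "M \<subseteq> N" using M(2) sub by blast
    show "(h has_real_derivative \<phi> (h t)) (at t)" if "t \<in> T" for t
    proof -
      have "h t \<in> N"
        using M(6) that \<open>M \<subseteq> N\<close> by (auto simp: homeomorphism_def)
      \<comment> \<open>Inverting multiplication by \<open>1 / \<phi>\<close> gives multiplication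
        by \<open>\<phi>\<close>, which turns the formula for the derivative of an inverse into the
        differential equation.\<close>
      then have "inv (blinfun_apply (D (h t))) = (*) (\<phi> (h t))"
        by (intro inv_equality) (use nz in \<open>auto simp: D\<close>)
      then show ?thesis
        using h[OF that] by (simp add: has_field_derivative_def)
    qed
  qed (use M \<Phi> in \<open>auto simp: \<Phi>_def subset_iff\<close>)
qed

section \<open>Equations with constant direction in suitable coordinates\<close>

text \<open>By the chain rule and the hypothesis on \<open>w\<close>, the image under
  \<open>f\<close> of a solution \<open>y\<close> has velocity
  \<open>\<delta> (y t) *\<^sub>R c\<close>, so it moves along a line and only a scalar equation for
  the position remains. Uniqueness is stated for germs: one curve \<open>\<eta>\<close> describes,
  up to a time shift, every solution passing through \<open>q\<close>. The point \<open>t0\<close>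
  may be an endpoint of \<open>J\<close>.\<close>

lemma rectified_ode:
  fixes f w :: "'a::euclidean_space \<Rightarrow> 'a" and f' :: "'a \<Rightarrow> 'a \<Rightarrow>\<^sub>L 'a"
  assumes "open U" "q \<in> U"
    and f': "\<And>x. x \<in> U \<Longrightarrow> (f has_derivative blinfun_apply (f' x)) (at x)" "continuous_on U f'"
    and invf: "invf o\<^sub>L f' q = id_blinfun"
    and w: "\<And>x. x \<in> U \<Longrightarrow> f' x (w x) = \<delta> x *\<^sub>R c"
    and \<delta>: "continuous_on U \<delta>" "\<And>x. x \<in> U \<Longrightarrow> \<delta> x \<noteq> 0"
    and c: "norm c = 1"
  obtains \<eta> \<epsilon> where "\<epsilon> > 0" "\<eta> 0 = q"
    "\<And>t. \<bar>t\<bar> < \<epsilon> \<Longrightarrow> \<eta> t \<in> U \<and> (\<eta> has_vector_derivative w (\<eta> t)) (at t)"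
    "\<And>J t0 y. \<lbrakk>is_interval J; t0 \<in> J; y t0 = q;
        \<And>t. t \<in> J \<Longrightarrow> (y has_vector_derivative w (y t)) (at t within J)\<rbrakk>
      \<Longrightarrow> \<exists>d>0. \<forall>t\<in>J. \<bar>t - t0\<bar> < d \<longrightarrow> y t = \<eta> (t - t0)"
proof -
  obtain U' W g g' where U': "open U'" "U' \<subseteq> U" "q \<in> U'" and W: "open W" "f q \<in> W"
    and hom: "homeomorphism U' W f g"
    and g: "\<And>y. y \<in> W \<Longrightarrow> (g has_derivative (g' y)) (at y)"
      "\<And>y. y \<in> W \<Longrightarrow> g' y = inv (blinfun_apply (f' (g y)))"
      "\<And>y. y \<in> W \<Longrightarrow> bij (blinfun_apply (f' (g y)))"
    using inverse_function_theorem[OF assms(1) f' assms(2) invf] by metis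
  have gf: "g (f x) = x" "f x \<in> W" if "x \<in> U'" for x
    using hom that by (auto simp: homeomorphism_def)
  have gW: "g z \<in> U'" if "z \<in> W" for z
    using hom that by (auto simp: homeomorphism_def)
  \<comment> \<open>\<open>\<kappa>\<close> parametrises the line through \<open>f q\<close> in
    direction \<open>c\<close>, \<open>N\<close> collects the parameters whose points lie in the
    domain \<open>W\<close> of the local inverse \<open>g\<close>, and \<open>\<phi>\<close> is the
    speed along this line.\<close>
  define \<kappa> where "\<kappa> r = f q + r *\<^sub>R c" for r
  define N where "N = \<kappa> -` W"
  define \<phi> where "\<phi> r = \<delta> (g (\<kappa> r))" for r
  have cont\<kappa>: "continuous_on S \<kappa>" for S
    unfolding \<kappa>_def by (intro continuous_intros)
  have "open N"
    unfolding N_def using W(1) cont\<kappa> by (rule open_vimage)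
  moreover have "0 \<in> N"
    using W by (simp add: N_def \<kappa>_def)
  moreover have "continuous_on N \<phi>"
    unfolding \<phi>_def
  proof (rule continuous_on_compose2[OF \<delta>(1)])
    show "continuous_on N (\<lambda>r. g (\<kappa> r))"
      by (rule continuous_on_compose2[OF _ cont\<kappa>, of W]) (use hom in \<open>auto simp: homeomorphism_def N_def\<close>)
    show "(\<lambda>r. g (\<kappa> r)) ` N \<subseteq> U" using gW U'(2) by (auto simp: N_def)
  qed
  moreover have nz: "\<phi> r \<noteq> 0" if "r \<in> N" for r
    using that gW U'(2) \<delta>(2) by (auto simp: N_def \<phi>_def)
  ultimately obtain M T \<Phi> h where M: "open M" "0 \<in> M" "M \<subseteq> N" and T: "open T" "0 \<in> T"
    and \<Phi>0: "\<Phi> 0 = 0" and homs: "homeomorphism M T \<Phi> h"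
    and \<Phi>: "\<And>r. r \<in> M \<Longrightarrow> (\<Phi> has_real_derivative 1 / \<phi> r) (at r)"
    and h: "\<And>t. t \<in> T \<Longrightarrow> (h has_real_derivative \<phi> (h t)) (at t)"
    using separable_ode[of N 0 \<phi>] by metis
  have h\<Phi>: "h (\<Phi> r) = r" if "r \<in> M" for r
    using homs that by (auto simp: homeomorphism_def)
  have hT: "h t \<in> M" if "t \<in> T" for t
    using homs that by (auto simp: homeomorphism_def)
  \<comment> \<open>Existence: solve the scalar equation by \<open>h\<close>, place the result on
    the line, and pull it back by \<open>g\<close>.\<close>
  define \<eta> where "\<eta> t = g (\<kappa> (h t))" for t
  obtain \<epsilon> where \<epsilon>: "\<epsilon> > 0" "ball 0 \<epsilon> \<subseteq> T"
    using T open_contains_ball by blast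
  show thesis
  proof (rule that[of \<epsilon> \<eta>])
    show "\<eta> 0 = q"
      using h\<Phi>[OF M(2)] gf U' by (simp add: \<Phi>0 \<eta>_def \<kappa>_def)
    show "\<eta> t \<in> U \<and> (\<eta> has_vector_derivative w (\<eta> t)) (at t)" if "\<bar>t\<bar> < \<epsilon>" for t
    proof
      have t: "t \<in> T" using that \<epsilon> by (auto simp: subset_iff)
      then have hN: "h t \<in> N" using hT M by blast
      then have W: "\<kappa> (h t) \<in> W" by (simp add: N_def)
      then show U: "\<eta> t \<in> U" using gW U' by (auto simp: \<eta>_def)
      have "(\<kappa> \<circ> h has_vector_derivative \<phi> (h t) *\<^sub>R c) (at t)"
        unfolding \<kappa>_def o_def using h[OF t] by (auto intro!: derivative_eq_intros simp: has_real_derivative_iff_has_vector_derivative)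
      from vector_derivative_diff_chain_within[OF this has_derivative_at_withinI[OF g(1)]]
      have "(\<eta> has_vector_derivative g' (\<kappa> (h t)) (\<phi> (h t) *\<^sub>R c)) (at t)"
        using W by (simp add: o_def \<eta>_def[abs_def])
      \<comment> \<open>With the velocity in this form, \<open>g'\<close> undoes \<open>f'\<close>
        and leaves exactly \<open>w (\<eta> t)\<close>.\<close>
      moreover have "\<phi> (h t) *\<^sub>R c = f' (\<eta> t) (w (\<eta> t))"
        using w[OF U] by (simp add: \<phi>_def \<eta>_def)
      ultimately show "(\<eta> has_vector_derivative w (\<eta> t)) (at t)"
        using g(2,3)[OF W] by (simp add: \<eta>_def bij_is_inj inv_f_f)
    qed
    fix J t0 and y :: "real \<Rightarrow> 'a"
    assume J: "is_interval J" "t0 \<in> J" and y0: "y t0 = q"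
      and y: "\<And>t. t \<in> J \<Longrightarrow> (y has_vector_derivative w (y t)) (at t within J)"
    \<comment> \<open>Position on the line: as \<open>norm c = 1\<close>, the inner product with
      \<open>c\<close> inverts \<open>\<kappa>\<close>.\<close>
    define r where "r t = (f (y t) - f q) \<bullet> c" for t
    have yc: "continuous (at t0 within J) y"
      using y[OF J(2)] by (rule has_vector_derivative_continuous)
    have "\<forall>\<^sub>F t in at t0 within J. y t \<in> U'"
      using yc U' y0 by (auto simp: continuous_within intro: topological_tendstoD)
    then obtain d1 where d1: "d1 > 0" "\<And>t. t \<in> J \<Longrightarrow> \<bar>t - t0\<bar> < d1 \<Longrightarrow> y t \<in> U'"
      using U' y0 unfolding eventually_at by (metis dist_real_def zero_less_dist_iff)
    have "continuous (at (y t0)) f"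
      using f'(1)[OF assms(2)] y0 has_derivative_continuous by metis
    then have "continuous (at t0 within J) (\<lambda>t. f (y t))"
      using yc by (rule continuous_within_compose3)
    then have "continuous (at t0 within J) r"
      unfolding r_def by (intro continuous_intros)
    moreover have r0: "r t0 = 0" by (simp add: r_def y0)
    ultimately have "\<forall>\<^sub>F t in at t0 within J. r t \<in> M"
      using M by (auto simp: continuous_within intro: topological_tendstoD)
    then obtain d2 where d2: "d2 > 0" "\<And>t. t \<in> J \<Longrightarrow> \<bar>t - t0\<bar> < d2 \<Longrightarrow> r t \<in> M"
      using M r0 unfolding eventually_at by (metis dist_real_def zero_less_dist_iff)
    \<comment> \<open>On \<open>K\<close> the curve stays where \<open>f\<close> is invertible and
      \<open>r\<close> stays where \<open>\<Phi>\<close> is. \<open>K\<close> may lie on one side of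
      \<open>t0\<close>; the zero-derivative arguments below rest on its convexity.\<close>
    define K where "K = J \<inter> ball t0 (min d1 d2)"
    have K: "convex K" "t0 \<in> K"
      using J d1 d2 by (auto simp: K_def is_interval_convex convex_Int)
    have KU: "y t \<in> U'" and KM: "r t \<in> M" if "t \<in> K" for t
      using that d1 d2 by (auto simp: K_def dist_real_def abs_minus_commute)
    have fy: "((\<lambda>t. f (y t)) has_vector_derivative \<delta> (y t) *\<^sub>R c) (at t within K)" if "t \<in> K" for t
    proof -
      have "(y has_vector_derivative w (y t)) (at t within K)"
        using y that by (auto simp: K_def intro: has_vector_derivative_within_subset)
      from vector_derivative_diff_chain_within[OF this has_derivative_at_withinI[OF f'(1)]]
      show ?thesis using KU[OF that] U' w by (auto simp: o_def)
    qed
    have r': "(r has_real_derivative \<delta> (y t)) (at t within K)" if "t \<in> K" for t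
    proof -
      have "(r has_vector_derivative (\<delta> (y t) *\<^sub>R c) \<bullet> c) (at t within K)"
        unfolding r_def
        by (rule bounded_linear.has_vector_derivative[OF bounded_linear_inner_left])
          (use fy[OF that] in \<open>auto intro!: derivative_eq_intros\<close>)
      then show ?thesis
        using c by (simp add: has_real_derivative_iff_has_vector_derivative dot_square_norm)
    qed
    \<comment> \<open>Both terms have derivative \<open>\<delta> (y t) *\<^sub>R c\<close> and they
      agree at \<open>t0\<close>, so \<open>f (y t)\<close> does not leave the line on
      \<open>K\<close>.\<close>
    have "((\<lambda>t. f (y t) - \<kappa> (r t)) has_vector_derivative 0) (at t within K)" if "t \<in> K" for t
      unfolding \<kappa>_def using fy[OF that] r'[OF that]
      by (auto intro!: derivative_eq_intros simp: has_real_derivative_iff_has_vector_derivative)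
    then obtain k where k: "\<And>t. t \<in> K \<Longrightarrow> f (y t) - \<kappa> (r t) = k"
      using has_vector_derivative_zero_constant[OF K(1)] by blast
    have "k = 0" using k[OF K(2)] by (simp add: r0 y0 \<kappa>_def)
    then have f\<kappa>: "f (y t) = \<kappa> (r t)" if "t \<in> K" for t using k[OF that] by simp
    have yg: "y t = g (\<kappa> (r t))" if "t \<in> K" for t
      using gf(1)[OF KU[OF that]] f\<kappa>[OF that] by simp
    \<comment> \<open>Separation of variables for an arbitrary solution: the factor
      \<open>1 / \<phi>\<close> cancels the speed, so \<open>\<Phi> (r t) = t - t0\<close>, and
      applying \<open>h\<close> determines \<open>y t\<close>.\<close>
    have "((\<lambda>t. \<Phi> (r t) - t) has_real_derivative 0) (at t within K)" if "t \<in> K" for t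
    proof -
      have "((\<lambda>t. \<Phi> (r t)) has_real_derivative 1 / \<phi> (r t) * \<delta> (y t)) (at t within K)"
        using DERIV_chain2[OF \<Phi>[OF KM[OF that]] r'[OF that]] .
      moreover have "\<delta> (y t) = \<phi> (r t)" using yg[OF that] by (simp add: \<phi>_def)
      moreover have "\<phi> (r t) \<noteq> 0" using KM[OF that] M nz by blast
      ultimately show ?thesis by (auto intro!: derivative_eq_intros)
    qed
    then obtain k' where k': "\<And>t. t \<in> K \<Longrightarrow> \<Phi> (r t) - t = k'"
      using has_field_derivative_zero_constant[OF K(1), of "\<lambda>t. \<Phi> (r t) - t"] by blast
    have "k' = - t0" using k'[OF K(2)] by (simp add: r0 \<Phi>0)
    then have \<Phi>r: "\<Phi> (r t) = t - t0" if "t \<in> K" for t using k'[OF that] by simp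
    have "y t = \<eta> (t - t0)" if "t \<in> K" for t
      using yg[OF that] \<Phi>r[OF that] h\<Phi>[OF KM[OF that]] by (simp add: \<eta>_def)
    then have "\<forall>t\<in>J. \<bar>t - t0\<bar> < min d1 d2 \<longrightarrow> y t = \<eta> (t - t0)"
      by (simp add: K_def dist_real_def abs_minus_commute)
    then show "\<exists>d>0. \<forall>t\<in>J. \<bar>t - t0\<bar> < d \<longrightarrow> y t = \<eta> (t - t0)"
      using d1(1) d2(1) by (meson min_less_iff_conj)
  qed (use \<epsilon> in auto)
qed

section \<open>From local to global uniqueness\<close>

text \<open>Two solutions that agree at a time \<open>s\<close> both follow the same germ
  \<open>\<eta>\<close> near \<open>s\<close>, so the set where they coincide is open in the common
  interval. It is closed by continuity and contains 0, hence it is the whole interval by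
  connectedness.\<close>

lemma ivp_unique_if_locally_unique:
  fixes w :: "'a::real_normed_vector \<Rightarrow> 'a"
  assumes local: "\<And>q. q \<in> V \<Longrightarrow> \<exists>\<eta> :: real \<Rightarrow> 'a. \<forall>J t0 y. is_interval J \<longrightarrow> t0 \<in> J \<longrightarrow> y t0 = q \<longrightarrow>
        (\<forall>t\<in>J. (y has_vector_derivative w (y t)) (at t within J)) \<longrightarrow>
        (\<exists>d>0. \<forall>t\<in>J. \<bar>t - t0\<bar> < d \<longrightarrow> y t = \<eta> (t - t0))"
    and y: "ivp_solution V w p I y" and z: "ivp_solution V w p I' z" and t: "t \<in> I \<inter> I'"
  shows "y t = z t"
proof -
  define J where "J = I \<inter> I'"
  have J: "is_interval J" "0 \<in> J" "y 0 = z 0"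
    using y z interior_subset unfolding ivp_solution_def J_def by (auto simp: is_interval_Int)
  have y': "y t \<in> V" "(y has_vector_derivative w (y t)) (at t within J)" if "t \<in> J" for t
    using y that unfolding ivp_solution_def J_def
    by (auto intro: has_vector_derivative_within_subset)
  have z': "(z has_vector_derivative w (z t)) (at t within J)" if "t \<in> J" for t
    using z that unfolding ivp_solution_def J_def
    by (auto intro: has_vector_derivative_within_subset)
  define E where "E = {t \<in> J. y t = z t}"
  have "openin (top_of_set J) E"
    unfolding openin_euclidean_subtopology_iff
  proof (intro conjI ballI)
    show "E \<subseteq> J" by (auto simp: E_def)
    fix s assume "s \<in> E"
    then have s: "s \<in> J" "y s = z s" by (auto simp: E_def)
    obtain \<eta> where \<eta>: "\<And>J t0 u. \<lbrakk>is_interval J; t0 \<in> J; u t0 = y s;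
        \<And>t. t \<in> J \<Longrightarrow> (u has_vector_derivative w (u t)) (at t within J)\<rbrakk> \<Longrightarrow>
        \<exists>d>0. \<forall>t\<in>J. \<bar>t - t0\<bar> < d \<longrightarrow> u t = \<eta> (t - t0)"
      using local[OF y'(1)[OF s(1)]] by metis
    obtain d1 where d1: "d1 > 0" "\<forall>t\<in>J. \<bar>t - s\<bar> < d1 \<longrightarrow> y t = \<eta> (t - s)"
      using \<eta>[of J s y] J s y' by blast
    obtain d2 where d2: "d2 > 0" "\<forall>t\<in>J. \<bar>t - s\<bar> < d2 \<longrightarrow> z t = \<eta> (t - s)"
      using \<eta>[of J s z] J s z' by metis
    show "\<exists>e>0. \<forall>x'\<in>J. dist x' s < e \<longrightarrow> x' \<in> E"
      using d1 d2 by (intro exI[of _ "min d1 d2"]) (auto simp: E_def dist_real_def)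
  qed
  moreover have "closedin (top_of_set J) E"
  proof -
    have "continuous_on J (\<lambda>t. y t - z t)"
      using y'(2) z' has_vector_derivative_continuous
      unfolding continuous_on_eq_continuous_within by (blast intro: continuous_diff)
    from continuous_closedin_preimage_constant[OF this, of 0]
    show ?thesis by (simp add: E_def)
  qed
  moreover have "connected J" using J(1) is_interval_connected by blast
  moreover have "0 \<in> E" using J by (simp add: E_def)
  ultimately have "E = J" by (metis connected_clopen empty_iff)
  then show ?thesis using t by (auto simp: E_def J_def)
qed


section \<open>The straightening map and its derivative\<close>

text \<open>The Frechet derivative is linear, hence determined by its values on the axis vectors,
  and these are the partial derivatives.\<close>

lemma has_derivative_gradient:
  assumes "f differentiable (at x)"
  shows "(f has_derivative (\<lambda>h. h \<bullet> gradient f x)) (at x)"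
proof -
  obtain f' where f': "(f has_derivative f') (at x)"
    using assms by (auto simp: differentiable_def)
  interpret bounded_linear f' using f' by (rule has_derivative_bounded_linear)
  have "partial_deriv j f x = f' (axis j 1)" for j
  proof -
    have "((\<lambda>t. f (x + t *\<^sub>R axis j 1)) has_derivative (\<lambda>t. f' (t *\<^sub>R axis j 1))) (at 0)"
      by (rule has_derivative_compose[where g = f]) (use f' in \<open>auto intro!: derivative_eq_intros\<close>)
    then have "((\<lambda>t. f (x + t *\<^sub>R axis j 1)) has_real_derivative f' (axis j 1)) (at 0)"
      by (simp add: has_field_derivative_def scaleR mult_commute_abs)
    then show ?thesis
      unfolding partial_deriv_def by (rule DERIV_imp_deriv)
  qed
  then have "f' h = h \<bullet> gradient f x" for h
    using arg_cong[OF basis_expansion[of h], of f']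
    by (simp add: sum scaleR inner_vec_def gradient_def scalar_mult_eq_scaleR)
  then show ?thesis
    by (intro has_derivative_eq_rhs[OF f'] ext)
qed

text \<open>The map \<open>G\<close> of the opening comment.\<close>

definition straightening ::
    "('l::finite \<Rightarrow> real ^ ('l + 'm::finite) \<Rightarrow> real) \<Rightarrow> real ^ ('l + 'm) \<Rightarrow> real ^ ('l + 'm)"
  where "straightening F x = (\<chi> i. case i of Inl a \<Rightarrow> F a x | Inr k \<Rightarrow> x $ Inr k)"

text \<open>Its matrix is block triangular with diagonal blocks \<open>jac F x\<close> and the
  identity, so its determinant is \<open>jac_det F x\<close>.\<close>

definition straightening_deriv :: "('l::finite \<Rightarrow> real ^ ('l + 'm::finite) \<Rightarrow> real) \<Rightarrow>
    real ^ ('l + 'm) \<Rightarrow> real ^ ('l + 'm) \<Rightarrow> real ^ ('l + 'm)"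
  where "straightening_deriv F x h =
    (\<chi> i. case i of Inl a \<Rightarrow> h \<bullet> gradient (F a) x | Inr k \<Rightarrow> h $ Inr k)"

lemma linear_straightening_deriv: "linear (straightening_deriv F x)"
  by (rule linearI) (auto simp: straightening_deriv_def vec_eq_iff inner_left_distrib split: sum.splits)

lemma has_derivative_straightening:
  assumes "\<And>a. F a differentiable (at x)"
  shows "(straightening F has_derivative straightening_deriv F x) (at x)"
proof -
  have "((\<lambda>y. straightening F y \<bullet> axis i 1) has_derivative
      (\<lambda>h. straightening_deriv F x h \<bullet> axis i 1)) (at x)" for i
    by (cases i) (auto simp: straightening_def straightening_deriv_def inner_axis
        intro: has_derivative_gradient[OF assms] bounded_linear_imp_has_derivative bounded_linear_vec_nth)
  then show ?thesis
    by (subst has_derivative_componentwise_within) (auto simp: Basis_vec_def)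
qed

text \<open>A kernel vector can be added to the vector characterised in \<open>vfield_ex1\<close>
  without violating either condition, so uniqueness there forces it to be 0. No block determinant
  has to be computed.\<close>

lemma inj_straightening_deriv:
  fixes F :: "'l::finite \<Rightarrow> real ^ ('l + 'm::finite) \<Rightarrow> real"
  assumes "jac_det F x \<noteq> 0"
  shows "inj (straightening_deriv F x)"
proof (subst linear_injective_0[OF linear_straightening_deriv], intro allI impI)
  fix h assume "straightening_deriv F x h = 0"
  then have h: "h \<bullet> gradient (F a) x = 0" "h $ Inr k = 0" for a k
    by (force simp: straightening_deriv_def vec_eq_iff split: sum.splits)+
  \<comment> \<open>Any \<open>s\<close> will do: it selects one vector \<open>w\<close> to be
    perturbed by \<open>h\<close>.\<close>
  fix s :: 'm
  obtain w where w: "\<forall>a. w \<bullet> gradient (F a) x = 0"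
      "\<forall>k. w $ Inr k = (if k = s then jac_det F x else 0)"
    and unique: "\<And>u. \<lbrakk>\<forall>a. u \<bullet> gradient (F a) x = 0;
      \<forall>k. u $ Inr k = (if k = s then jac_det F x else 0)\<rbrakk> \<Longrightarrow> u = w"
    using vfield_ex1[OF assms, of s, unfolded Ex1_def] by blast
  have "w + h = w"
    using w h by (intro unique) (simp_all add: inner_left_distrib)
  then show "h = 0" by simp
qed

text \<open>Orthogonality to the gradients annihilates the first block, and the prescribed last
  components give the second. This identity brings \<open>vfield\<close> within the scope of
  \<open>rectified_ode\<close>.\<close>

lemma straightening_deriv_vfield:
  assumes "jac_det F x \<noteq> 0"
  shows "straightening_deriv F x (vfield F s x) = jac_det F x *\<^sub>R axis (Inr s) 1"
  using theI'[OF vfield_ex1[OF assms, of s], folded vfield_def]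
  by (auto simp: straightening_deriv_def vec_eq_iff axis_def split: sum.splits)

lemma continuous_on_jac_det:
  assumes "\<And>j. C1_on V (F j)"
  shows "continuous_on V (jac_det F)"
  using assms unfolding jac_det_def[abs_def] det_def jac_def C1_on_def
  by (auto intro!: continuous_intros)

section \<open>Existence and uniqueness for a single field\<close>

text \<open>An instance of \<open>rectified_ode\<close>: \<open>f\<close> is the straightening map,
  \<open>\<delta>\<close> is \<open>jac_det F\<close>, and \<open>c\<close> is the coordinate
  direction \<open>axis (Inr s) 1\<close>.\<close>

lemma vfield_local_solution:
  fixes F :: "'l::finite \<Rightarrow> real ^ ('l + 'm::finite) \<Rightarrow> real"
  assumes "open V" and C1: "\<And>j. C1_on V (F j)" and nz: "\<And>x. x \<in> V \<Longrightarrow> jac_det F x \<noteq> 0" and "q \<in> V"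
  obtains \<eta> \<epsilon> where "\<epsilon> > 0" "\<eta> 0 = q"
    "\<And>t. \<bar>t\<bar> < \<epsilon> \<Longrightarrow> \<eta> t \<in> V \<and> (\<eta> has_vector_derivative vfield F s (\<eta> t)) (at t)"
    "\<And>J t0 y. \<lbrakk>is_interval J; t0 \<in> J; y t0 = q;
        \<And>t. t \<in> J \<Longrightarrow> (y has_vector_derivative vfield F s (y t)) (at t within J)\<rbrakk>
      \<Longrightarrow> \<exists>d>0. \<forall>t\<in>J. \<bar>t - t0\<bar> < d \<longrightarrow> y t = \<eta> (t - t0)"
proof -
  define D where "D x = Blinfun (straightening_deriv F x)" for x
  have D: "blinfun_apply (D x) = straightening_deriv F x" for x
    unfolding D_def using linear_straightening_deriv linear_conv_bounded_linear
    by (metis bounded_linear_Blinfun_apply)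
  have contD: "continuous_on V D"
  proof (rule continuous_on_blinfun_componentwise)
    fix i :: "real ^ ('l + 'm)"
    have "continuous_on V (\<lambda>x. case k of Inl a \<Rightarrow> i \<bullet> gradient (F a) x | Inr k \<Rightarrow> i $ Inr k)" for k
      using C1 by (cases k) (auto simp: C1_on_def gradient_def intro!: continuous_intros)
    then show "continuous_on V (\<lambda>x. blinfun_apply (D x) i)"
      unfolding D straightening_deriv_def by (rule continuous_on_vec_lambda)
  qed
  \<comment> \<open>Injectivity of the derivative at \<open>q\<close> yields the left inverse that
    \<open>rectified_ode\<close> asks for.\<close>
  obtain g where "linear g" and g: "g \<circ> straightening_deriv F q = id"
    using linear_injective_left_inverse[OF linear_straightening_deriv inj_straightening_deriv[OF nz[OF \<open>q \<in> V\<close>]]]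
    by blast
  have inv: "Blinfun g o\<^sub>L D q = id_blinfun"
    by (rule blinfun_eqI) (use \<open>linear g\<close> fun_cong[OF g] in
      \<open>simp add: D bounded_linear_Blinfun_apply linear_conv_bounded_linear\<close>)
  show thesis
  proof (rule rectified_ode[of V q "straightening F" D "Blinfun g" "vfield F s" "jac_det F" "axis (Inr s) 1"])
    show "(straightening F has_derivative blinfun_apply (D x)) (at x)" if "x \<in> V" for x
      unfolding D using C1 that by (intro has_derivative_straightening) (auto simp: C1_on_def)
    show "blinfun_apply (D x) (vfield F s x) = jac_det F x *\<^sub>R axis (Inr s) 1" if "x \<in> V" for x
      unfolding D using nz[OF that] by (rule straightening_deriv_vfield)
    show "continuous_on V (jac_det F)" using C1 by (rule continuous_on_jac_det)
    show "norm (axis (Inr s) 1 :: real ^ ('l + 'm)) = 1" by (simp add: norm_eq_1 inner_axis_axis)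
  qed (fact assms contD inv nz that)+
qed

lemma vfield_ivp_exists:
  assumes "open V" "\<And>j. C1_on V (F j)" "\<And>x. x \<in> V \<Longrightarrow> jac_det F x \<noteq> 0" "q \<in> V"
  shows "\<exists>I y. ivp_solution V (vfield F s) q I y"
proof -
  obtain \<eta> \<epsilon> where \<epsilon>: "\<epsilon> > 0" and \<eta>: "\<eta> 0 = q"
    "\<And>t. \<bar>t\<bar> < \<epsilon> \<Longrightarrow> \<eta> t \<in> V \<and> (\<eta> has_vector_derivative vfield F s (\<eta> t)) (at t)"
    by (rule vfield_local_solution[of V F q s, OF assms]) (assumption, rule that)
  have "ivp_solution V (vfield F s) q {- \<epsilon> <..< \<epsilon>} \<eta>"
    unfolding ivp_solution_def
  proof (intro conjI ballI)
    fix t assume "t \<in> {- \<epsilon> <..< \<epsilon>}"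
    then have "\<bar>t\<bar> < \<epsilon>" by auto
    from \<eta>(2)[OF this] show "\<eta> t \<in> V"
      "(\<eta> has_vector_derivative vfield F s (\<eta> t)) (at t within {- \<epsilon> <..< \<epsilon>})"
      by (auto intro: has_vector_derivative_at_within)
  qed (use \<epsilon> \<eta>(1) in \<open>auto simp: is_interval_oo interior_open\<close>)
  then show ?thesis by blast
qed

lemma vfield_ivp_unique:
  assumes "open V" "\<And>j. C1_on V (F j)" "\<And>x. x \<in> V \<Longrightarrow> jac_det F x \<noteq> 0"
    and "ivp_solution V (vfield F s) q I y" "ivp_solution V (vfield F s) q I' z" "t \<in> I \<inter> I'"
  shows "y t = z t"
proof (rule ivp_unique_if_locally_unique[OF _ assms(4-6)])
  fix p assume "p \<in> V"
  with assms(1-3) obtain \<eta> where "\<And>J t0 y. \<lbrakk>is_interval J; t0 \<in> J; y t0 = p;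
        \<And>t. t \<in> J \<Longrightarrow> (y has_vector_derivative vfield F s (y t)) (at t within J)\<rbrakk>
      \<Longrightarrow> \<exists>d>0. \<forall>t\<in>J. \<bar>t - t0\<bar> < d \<longrightarrow> y t = \<eta> (t - t0)"
    using vfield_local_solution[of V F p s] by metis
  then show "\<exists>\<eta>. \<forall>J t0 y. is_interval J \<longrightarrow> t0 \<in> J \<longrightarrow> y t0 = p \<longrightarrow>
        (\<forall>t\<in>J. (y has_vector_derivative vfield F s (y t)) (at t within J)) \<longrightarrow>
        (\<exists>d>0. \<forall>t\<in>J. \<bar>t - t0\<bar> < d \<longrightarrow> y t = \<eta> (t - t0))"
    by blast
qed

section \<open>The iterated system\<close>

text \<open>Only the last variable is differentiated, so a solution and its interval can be chosen
  independently over each parameter tuple.\<close>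

lemma subsystem_solution_exists:
  assumes ex: "\<And>q. q \<in> V \<Longrightarrow> \<exists>I y. ivp_solution V f q I y" and V: "\<And>ts. ts \<in> D' \<Longrightarrow> y' ts \<in> V"
  shows "\<exists>D y. subsystem_solution V f D' y' D y"
proof -
  have "\<forall>ts\<in>D'. \<exists>I Y. ivp_solution V f (y' ts) I Y"
    using ex V by blast
  then obtain I Y where IY: "\<And>ts. ts \<in> D' \<Longrightarrow> ivp_solution V f (y' ts) (I ts) (Y ts)"
    by metis
  \<comment> \<open>\<open>butlast\<close> recovers the parameters of a tuple and
    \<open>last\<close> the new time.\<close>
  have "subsystem_solution V f D' y' {ts @ [t] | ts t. ts \<in> D' \<and> t \<in> I ts}
      (\<lambda>us. Y (butlast us) (last us))"
    unfolding subsystem_solution_def using IY by auto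
  then show ?thesis by blast
qed

lemma iterated_solution_Suc:
  "iterated_solution V v p (Suc n) D y \<longleftrightarrow> iterated_solution V v p n D y \<and>
    subsystem_solution V (v (Suc n)) (D n) (y n) (D (Suc n)) (y (Suc n))"
  by (auto simp: iterated_solution_def atLeastAtMostSuc_conv)

text \<open>The values of one stage are the initial values of the next, and existence is available
  for initial values in \<open>V\<close>. At stage 0 the value is \<open>p\<close>; later
  \<open>ivp_solution\<close> keeps the curve in \<open>V\<close>.\<close>

lemma iterated_solution_in:
  assumes "iterated_solution V v p n D y" "p \<in> V" "us \<in> D n"
  shows "y n us \<in> V"
proof (cases n)
  case 0
  then show ?thesis using assms by (auto simp: iterated_solution_def)
next
  case (Suc m)
  then have sol: "subsystem_solution V (v n) (D m) (y m) (D n) (y n)"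
    using assms(1) by (simp add: iterated_solution_Suc)
  then obtain ts t where "us = ts @ [t]" "ts \<in> D m"
    using assms(3) by (auto simp: subsystem_solution_def)
  then show ?thesis
    using sol assms(3) by (auto simp: subsystem_solution_def ivp_solution_def)
qed

lemma iterated_solution_exists:
  assumes "\<And>j q. q \<in> V \<Longrightarrow> \<exists>I y. ivp_solution V (v j) q I y" "p \<in> V"
  shows "\<exists>D y. iterated_solution V v p n D y"
proof (induction n)
  case 0
  \<comment> \<open>For \<open>n = 0\<close> only stage 0 is constrained; the entries at other
    indices are placeholders, overwritten stage by stage below.\<close>
  show ?case
    by (rule exI[of _ "\<lambda>_. {[]}"], rule exI[of _ "\<lambda>_ _. p"]) (simp add: iterated_solution_def)
next
  case (Suc n)
  then obtain D y where Dy: "iterated_solution V v p n D y" by blast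
  then obtain D' y' where new: "subsystem_solution V (v (Suc n)) (D n) (y n) D' y'"
    using subsystem_solution_exists[of V "v (Suc n)" "D n" "y n"] assms iterated_solution_in by metis
  have "iterated_solution V v p n (D(Suc n := D')) (y(Suc n := y'))"
    using Dy by (auto simp: iterated_solution_def)
  then have "iterated_solution V v p (Suc n) (D(Suc n := D')) (y(Suc n := y'))"
    using new by (simp add: iterated_solution_Suc)
  then show ?case by blast
qed

text \<open>By induction both families start the next stage from the same value over a common tuple,
  and uniqueness for a single field then applies on the intersection of the two fibres.\<close>

lemma iterated_solution_unique:
  assumes unique: "\<And>j q I I' y z t. \<lbrakk>ivp_solution V (v j) q I y; ivp_solution V (v j) q I' z; t \<in> I \<inter> I'\<rbrakk>
      \<Longrightarrow> y t = z t"
    and "iterated_solution V v p n D y" "iterated_solution V v p n D' y'" "us \<in> D n \<inter> D' n"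
  shows "y n us = y' n us"
  using assms(2-)
proof (induction n arbitrary: us)
  case 0
  then show ?case by (auto simp: iterated_solution_def)
next
  case (Suc n)
  then have sol: "subsystem_solution V (v (Suc n)) (D n) (y n) (D (Suc n)) (y (Suc n))"
    "subsystem_solution V (v (Suc n)) (D' n) (y' n) (D' (Suc n)) (y' (Suc n))"
    by (auto simp: iterated_solution_Suc)
  then have "D (Suc n) \<subseteq> {ts @ [t] | ts t. ts \<in> D n}" "D' (Suc n) \<subseteq> {ts @ [t] | ts t. ts \<in> D' n}"
    by (simp_all add: subsystem_solution_def)
  \<comment> \<open>The splitting of \<open>us\<close> into parameters and last time is unique, so
    the same \<open>ts\<close> lies in both domains of stage \<open>n\<close>.\<close>
  with Suc.prems(3) obtain ts t where us: "us = ts @ [t]" "ts \<in> D n" "ts \<in> D' n"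
    by blast
  then have "y n ts = y' n ts"
    using Suc.IH[of ts] Suc.prems by (simp add: iterated_solution_Suc)
  then have "ivp_solution V (v (Suc n)) (y n ts) {t. ts @ [t] \<in> D (Suc n)} (\<lambda>t. y (Suc n) (ts @ [t]))"
    "ivp_solution V (v (Suc n)) (y n ts) {t. ts @ [t] \<in> D' (Suc n)} (\<lambda>t. y' (Suc n) (ts @ [t]))"
    using sol us by (auto simp: subsystem_solution_def)
  from unique[OF this, of t] show ?case using us Suc.prems(3) by simp
qed

theorem theorem2:
  fixes F :: "'l::finite \<Rightarrow> real ^ ('l + 'm::finite) \<Rightarrow> real"
    and \<Omega> V :: "(real ^ ('l + 'm)) set"
    and x0 :: "real ^ ('l + 'm)"
    and e :: "nat \<Rightarrow> 'm"
    and v :: "nat \<Rightarrow> real ^ ('l + 'm) \<Rightarrow> real ^ ('l + 'm)"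
  assumes dims: "CARD('l + 'm) \<ge> 3" "1 \<le> CARD('l)" "CARD('l) \<le> CARD('l + 'm) - 2"
    and numbering: "bij_betw e {1..CARD('m)} UNIV"
    and domain: "open \<Omega>" "connected \<Omega>" "bounded \<Omega>" "x0 \<in> \<Omega>"
    and C1: "\<And>j. C1_on \<Omega> (F j)"
    and zero: "\<And>j. F j x0 = 0"
    and nondeg: "jac_det F x0 \<noteq> 0"
    and nbhd: "open V" "x0 \<in> V" "V \<subseteq> \<Omega>" "\<And>x. x \<in> V \<Longrightarrow> jac_det F x \<noteq> 0"
  defines "v \<equiv> \<lambda>j. vfield F (e j)"
  shows "(\<exists>D y. iterated_solution V v x0 (CARD('m)) D y) \<and>
    (\<forall>j\<in>{1..CARD('m)}.
      (\<forall>D y. iterated_solution V v x0 (j - 1) D y \<longrightarrow>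
        (\<exists>Dj yj. subsystem_solution V (v j) (D (j - 1)) (y (j - 1)) Dj yj)) \<and>
      (\<forall>D y D' y'. iterated_solution V v x0 j D y \<longrightarrow> iterated_solution V v x0 j D' y' \<longrightarrow>
        (\<forall>ts \<in> D j \<inter> D' j. y j ts = y' j ts)))"
proof -
  have C1V: "C1_on V (F j)" for j
    using C1[of j] nbhd(3) unfolding C1_on_def by (meson continuous_on_subset subsetD)
  have ex: "\<exists>I y. ivp_solution V (v j) q I y" if "q \<in> V" for j q
    unfolding v_def using vfield_ivp_exists[OF nbhd(1) C1V nbhd(4) that] by blast
  have unique: "y t = z t"
    if "ivp_solution V (v j) q I y" "ivp_solution V (v j) q I' z" "t \<in> I \<inter> I'" for j q I I' y z t
    using vfield_ivp_unique[OF nbhd(1) C1V nbhd(4)] that unfolding v_def by blast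
  show ?thesis
  proof (intro conjI ballI allI impI)
    show "\<exists>D y. iterated_solution V v x0 CARD('m) D y"
      using ex nbhd(2) by (rule iterated_solution_exists)
  next
    \<comment> \<open>Every solution of the earlier subsystems can be continued, not only the one
      built for the first claim, because its values lie in \<open>V\<close>.\<close>
    fix j D y assume "iterated_solution V v x0 (j - 1) D y"
    then show "\<exists>Dj yj. subsystem_solution V (v j) (D (j - 1)) (y (j - 1)) Dj yj"
      using subsystem_solution_exists[OF ex] iterated_solution_in[OF _ nbhd(2)] by metis
  next
    fix j D y D' y' ts
    assume sol: "iterated_solution V v x0 j D y" "iterated_solution V v x0 j D' y'" "ts \<in> D j \<inter> D' j"
    show "y j ts = y' j ts"
      by (rule iterated_solution_unique[OF _ sol]) (rule unique)
  qed
qed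

end
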